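(* Let $\mathcal X=[a,b]\subset\mathbb R$ with $-\infty<a<b<\infty$, and let $\alpha(x)$, $\beta(x)$ be real algebraic polynomials with $\beta(x)>0$ on $\mathcal X$. Suppose that the univariate vector field $F(x)=\alpha(x)/\beta(x)$ is nondecreasing on $\mathcal X$, and that $\mathcal K$ contains all semidefinite cones. Then the set $$\mathcal Y_+:=\mathrm{Conv}\{[xF(x);F(x);x]: x\in\mathcal X\}+\{[t;0;0]:t\geq0\}\subset\mathbb R^3$$ admits an explicit $\mathcal K$-representation, and this representation is a $\mathcal K$-representation of $(F,\mathcal X)$.
   Context: $\mathcal K$ is a fixed family of regular cones (closed, convex, pointed, with nonempty interior) in Euclidean spaces which contains $\mathbb R_+$, is closed under finite direct products, and is closed under passing to dual cones. $a\leq_{\mathbf K}b$ means $b-a\in\mathbf K$. A $\mathcal K$-representation of a set $Y$ is a constraint $Ay+Bu\leq_{\mathbf K}c$, $\mathbf K\in\mathcal K$ (or an equivalent finite system of such constraints, linear equalities and nonstrict linear inequalities), with $Y=\{y:\exists u: Ay+Bu\leq_{\mathbf K}c\}$. Semidefinite cones are the cones $\mathbf S^k_+$ of positive semidefinite symmetric $k\times k$ matrices. Let $\mathcal X$ be a nonempty convex subset of a Euclidean space $E$. A vector field $F:\mathcal X\to E$ is monotone if $\langle F(x)-F(y),x-y\rangle\geq0$ for all $x,y\in\mathcal X$. For continuous monotone $F$ put $$\mathcal F[F,\mathcal X]=\{[t;g;x]\in\mathbb R\times E\times E: x\in\mathcal X,\ t-\langle g,y\rangle\geq\langle F(y),x-y\rangle\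 \forall y\in\mathcal X\}.$$ A conic constraint $Xx+Gg+tT+Uu\leq_{\mathbf K}a$, $\mathbf K\in\mathcal K$ (or an equivalent finite system), in variables $t,g,x$ and additional variables $u$, with projection $\mathcal T$ of its solution set on the space of $[t;g;x]$, is a $\mathcal K$-representation of $(F,\mathcal X)$ if (i) $\mathcal T\subset\mathcal F[F,\mathcal X]$ and $[t;g;x]\in\mathcal T$, $t'\geq t$ imply $[t';g;x]\in\mathcal T$; and (ii) $\mathcal T\supset\{[\langle F(x),x\rangle;F(x);x]:x\in\mathcal X\}$. *)

theory Defs
  imports "HOL-Analysis.Analysis" "HOL-Computational_Algebra.Polynomial" "HOL-Library.Nat_Bijection"
begin

section \<open>Cones in Euclidean spaces\<close>

text \<open>
  \<^term>\<open>Euclidean_space n\<close> from HOL-Analysis is the space \<open>\<real>\<^sup>n\<close>, realised as the functions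
  \<^typ>\<open>nat \<Rightarrow> real\<close> that vanish from index \<open>n\<close> on. A cone together with its ambient space is a pair
  \<open>(n, C)\<close>, so that a family of cones may contain cones of different dimensions.
\<close>

type_synonym rvec = "nat \<Rightarrow> real"
type_synonym econe = "nat \<times> rvec set"

definition trunc :: "nat \<Rightarrow> rvec \<Rightarrow> rvec" where
  "trunc n x = (\<lambda>i. if i < n then x i else 0)"

definition regular_cone :: "econe \<Rightarrow> bool" where
  "regular_cone K \<longleftrightarrow> (case K of (n, C) \<Rightarrow>
     C \<subseteq> topspace (Euclidean_space n) \<and>
     (\<forall>x\<in>C. \<forall>r\<ge>0. (\<lambda>i. r * x i) \<in> C) \<and>
     (\<forall>x\<in>C. \<forall>y\<in>C. \<forall>u\<ge>0. \<forall>v\<ge>0. u + v = 1 \<longrightarrow> (\<lambda>i. u * x i + v * y i) \<in> C) \<and>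
     closedin (Euclidean_space n) C \<and>
     (\<forall>x. x \<in> C \<and> (\<lambda>i. - x i) \<in> C \<longrightarrow> x = (\<lambda>_. 0)) \<and>
     (Euclidean_space n) interior_of C \<noteq> {})"

definition dual_cone :: "econe \<Rightarrow> econe" where
  "dual_cone K = (case K of (n, C) \<Rightarrow>
     (n, {z \<in> topspace (Euclidean_space n). \<forall>x\<in>C. (\<Sum>i<n. z i * x i) \<ge> 0}))"

definition vconcat :: "nat \<Rightarrow> rvec \<Rightarrow> rvec \<Rightarrow> rvec" where
  "vconcat m x y = (\<lambda>i. if i < m then x i else y (i - m))"

definition prod_cone :: "econe \<Rightarrow> econe \<Rightarrow> econe" where
  "prod_cone K L = (case K of (m, C) \<Rightarrow> case L of (n, D) \<Rightarrow>
     (m + n, {vconcat m x y | x y. x \<in> C \<and> y \<in> D}))"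

definition orthant :: "nat \<Rightarrow> econe" where
  "orthant n = (n, {x \<in> topspace (Euclidean_space n). \<forall>i<n. x i \<ge> 0})"

text \<open>Closure under binary products gives closure under all (nonempty) finite products.\<close>

definition cone_family :: "econe set \<Rightarrow> bool" where
  "cone_family \<K> \<longleftrightarrow>
     (\<forall>K\<in>\<K>. regular_cone K) \<and>
     orthant 1 \<in> \<K> \<and>
     (\<forall>K\<in>\<K>. \<forall>L\<in>\<K>. prod_cone K L \<in> \<K>) \<and>
     (\<forall>K\<in>\<K>. dual_cone K \<in> \<K>)"

text \<open>
  The Euclidean space of symmetric \<open>k \<times> k\<close> matrices with the Frobenius inner product is
  identified with \<open>\<real>\<^sup>N\<close>, \<open>N = triangle k = k (k + 1) / 2\<close>, by the isometry \<open>svec\<close>: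
  coordinate \<open>l\<close> with \<open>prod_decode l = (p, q)\<close> carries the entry at position \<open>(p, p + q)\<close>,
  off-diagonal entries being scaled by \<open>sqrt 2\<close>; \<open>l < triangle k\<close> holds iff \<open>p + q < k\<close>.
\<close>

definition svec_weight :: "nat \<Rightarrow> real" where
  "svec_weight q = (if q = 0 then 1 else sqrt 2)"

definition svec :: "nat \<Rightarrow> (nat \<Rightarrow> nat \<Rightarrow> real) \<Rightarrow> rvec" where
  "svec k M = trunc (triangle k) (\<lambda>l. case prod_decode l of (p, q) \<Rightarrow> svec_weight q * M p (p + q))"

definition psd_matrix :: "nat \<Rightarrow> (nat \<Rightarrow> nat \<Rightarrow> real) \<Rightarrow> bool" where
  "psd_matrix k M \<longleftrightarrow>
     (\<forall>i<k. \<forall>j<k. M i j = M j i) \<and>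
     (\<forall>z::nat \<Rightarrow> real. (\<Sum>i<k. \<Sum>j<k. z i * M i j * z j) \<ge> 0)"

definition semidefinite_cone :: "nat \<Rightarrow> econe" where
  "semidefinite_cone k = (triangle k, {svec k M | M. psd_matrix k M})"

section \<open>Conic representations\<close>

text \<open>
  A conic constraint \<open>A y + B u \<le>\<^sub>K c\<close> in \<open>y\<close> from a Euclidean space and
  \<open>u \<in> \<real>\<^sup>q\<close>, \<open>q = num_aux\<close>. The linear map \<open>y \<mapsto> A y\<close> is given by its rows: its \<open>i\<close>-th component is
  \<open>row_A i \<bullet> y\<close>. Only the components below the dimension of the cone matter.
\<close>

record 'y conic_constraint =
  con_cone :: econe
  num_aux :: nat
  row_A :: "nat \<Rightarrow> 'y"
  mat_B :: "nat \<Rightarrow> nat \<Rightarrow> real"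
  rhs_c :: rvec

definition cone_le :: "econe \<Rightarrow> rvec \<Rightarrow> rvec \<Rightarrow> bool" where
  "cone_le K a b \<longleftrightarrow> (\<lambda>i. b i - a i) \<in> snd K"

definition satisfies :: "'y::euclidean_space conic_constraint \<Rightarrow> 'y \<Rightarrow> rvec \<Rightarrow> bool" where
  "satisfies R y u \<longleftrightarrow>
     cone_le (con_cone R)
       (trunc (fst (con_cone R)) (\<lambda>i. row_A R i \<bullet> y + (\<Sum>j<num_aux R. mat_B R i j * u j)))
       (trunc (fst (con_cone R)) (rhs_c R))"

definition projection :: "'y::euclidean_space conic_constraint \<Rightarrow> 'y set" where
  "projection R = {y. \<exists>u. satisfies R y u}"

definition K_representation ::
  "econe set \<Rightarrow> 'y::euclidean_space conic_constraint \<Rightarrow> 'y set \<Rightarrow> bool" where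
  "K_representation \<K> R Y \<longleftrightarrow> con_cone R \<in> \<K> \<and> Y = projection R"

section \<open>Representations of monotone vector fields\<close>

definition monotone_field :: "('a::euclidean_space \<Rightarrow> 'a) \<Rightarrow> 'a set \<Rightarrow> bool" where
  "monotone_field F X \<longleftrightarrow> (\<forall>x\<in>X. \<forall>y\<in>X. (F x - F y) \<bullet> (x - y) \<ge> 0)"

definition field_set ::
  "('a::euclidean_space \<Rightarrow> 'a) \<Rightarrow> 'a set \<Rightarrow> (real \<times> 'a \<times> 'a) set" where
  "field_set F X = {(t, g, x). x \<in> X \<and> (\<forall>y\<in>X. t - g \<bullet> y \<ge> F y \<bullet> (x - y))}"

text \<open>
  The first four conjuncts are the standing assumptions under which the notion is introduced.
\<close>

definition field_K_representation ::
  "econe set \<Rightarrow> (real \<times> 'a \<times> 'a) conic_constraint \<Rightarrow>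
     ('a::euclidean_space \<Rightarrow> 'a) \<Rightarrow> 'a set \<Rightarrow> bool" where
  "field_K_representation \<K> R F X \<longleftrightarrow>
     X \<noteq> {} \<and> convex X \<and> continuous_on X F \<and> monotone_field F X \<and>
     con_cone R \<in> \<K> \<and>
     projection R \<subseteq> field_set F X \<and>
     (\<forall>t g x t'. (t, g, x) \<in> projection R \<and> t' \<ge> t \<longrightarrow> (t', g, x) \<in> projection R) \<and>
     (\<lambda>x. (F x \<bullet> x, F x, x)) ` X \<subseteq> projection R"

section \<open>The explicit representation for univariate rational fields\<close>

text \<open>
  Substituting \<open>x = (a + b z\<^sup>2) / (1 + z\<^sup>2)\<close>, which maps the real line together with \<open>z = \<infinity>\<close> onto
  \<open>[a, b]\<close>, turns a polynomial \<open>p\<close> of degree at most \<open>d\<close> into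
  \<open>lift_poly d a b p / (1 + z\<^sup>2)\<^sup>d\<close>, whose numerator has degree at most \<open>2 d\<close>.
  The additional variables \<open>u\<^sub>0, \<dots>, u\<^sub>2\<^sub>d\<close> stand for the moments \<open>u\<^sub>j = \<integral> z\<^sup>j d\<mu>(z)\<close> of a
  nonnegative measure \<open>\<mu>\<close> (an atom at \<open>z = \<infinity>\<close> contributing to \<open>u\<^sub>2\<^sub>d\<close> only), and
  \<open>L(p) = \<Sum>\<^sub>j coeff (lift_poly d a b p) j * u\<^sub>j\<close> for the corresponding integral of \<open>p\<close>.
\<close>

definition lift_poly :: "nat \<Rightarrow> real \<Rightarrow> real \<Rightarrow> real poly \<Rightarrow> real poly" where
  "lift_poly d a b p = (\<Sum>i\<le>d. smult (coeff p i) ([:a, 0, b:] ^ i * [:1, 0, 1:] ^ (d - i)))"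

text \<open>
  A triple \<open>(A, q, c)\<close> stands for the scalar inequality
  \<open>A \<bullet> y + \<Sum>\<^sub>j coeff q j * u\<^sub>j \<le> c\<close>. In the variables \<open>y = (t, g, x)\<close> the list says
  \<open>L(x\<alpha>) \<le> t\<close>, \<open>L(\<alpha>) = g\<close>, \<open>L(x\<beta>) = x\<close>, \<open>L(\<beta>) = 1\<close>.
\<close>

definition scalar_rows ::
  "nat \<Rightarrow> real \<Rightarrow> real \<Rightarrow> real poly \<Rightarrow> real poly \<Rightarrow>
     ((real \<times> real \<times> real) \<times> real poly \<times> real) list" where
  "scalar_rows d a b \<alpha> \<beta> =
     (let l = lift_poly d a b; X = [:0, 1:] in
      [((-1, 0, 0), l (X * \<alpha>), 0),
       ((0, -1, 0), l \<alpha>, 0), ((0, 1, 0), - l \<alpha>, 0),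
       ((0, 0, -1), l (X * \<beta>), 0), ((0, 0, 1), - l (X * \<beta>), 0),
       (0, l \<beta>, 1), (0, - l \<beta>, -1)])"

text \<open>
  The seven scalar inequalities, followed by the condition that the Hankel matrix
  with entries \<open>u\<^sub>i\<^sub>+\<^sub>j\<close>, \<open>0 \<le> i, j \<le> d\<close>, is positive semidefinite.
\<close>

definition moment_representation ::
  "real \<Rightarrow> real \<Rightarrow> real poly \<Rightarrow> real poly \<Rightarrow> (real \<times> real \<times> real) conic_constraint" where
  "moment_representation a b \<alpha> \<beta> =
     (let d = max (degree \<alpha>) (degree \<beta>) + 1; S = scalar_rows d a b \<alpha> \<beta> in
      \<lparr> con_cone = prod_cone (orthant 7) (semidefinite_cone (d + 1)),
        num_aux = 2 * d + 1,
        row_A = (\<lambda>i. if i < 7 then fst (S ! i) else 0),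
        mat_B = (\<lambda>i j. if i < 7 then coeff (fst (snd (S ! i))) j
                 else case prod_decode (i - 7) of (p, q) \<Rightarrow>
                        if j = p + (p + q) then - svec_weight q else 0),
        rhs_c = (\<lambda>i. if i < 7 then snd (snd (S ! i)) else 0) \<rparr>)"

end

theory Submission
  imports Defs "HOL-Computational_Algebra.Fundamental_Theorem_Algebra"
begin

text \<open>
  By the substitution \<open>x = (a + b z\<^sup>2) / (1 + z\<^sup>2)\<close>, a polynomial nonnegative on \<open>[a, b]\<close> lifts to one
  that is nonnegative on the whole line, hence to a sum of squares, and the functional \<open>L\<close> belonging
  to a positive semidefinite Hankel matrix is nonnegative on it. If \<open>(L(x\<alpha>), L(\<alpha>), L(x\<beta>))\<close> were
  outside the compact convex hull of the curve \<open>(x F(x), F(x), x)\<close>, a separating affine function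
  multiplied by \<open>\<beta>\<close> would be a polynomial nonnegative on \<open>[a, b]\<close> with \<open>L < 0\<close>. Conversely, point
  evaluations are such functionals \<open>L\<close>, and the feasible set is convex.
\<close>

section \<open>Nonnegative polynomials as sums of squares\<close>

text \<open>A nonconstant polynomial that is bounded below can only tend to plus infinity in both
  directions, so its minimum over a large ball around 0 is global.\<close>

lemma poly_bounded_below_attains_min:
  fixes p :: "real poly"
  assumes "\<And>x. m \<le> poly p x"
  obtains x0 where "\<And>x. poly p x0 \<le> poly p x"
proof (cases "degree p = 0")
  case True
  then obtain c where "p = [:c:]"
    by (metis degree_eq_zeroE)
  then show ?thesis
    using that[of 0] by simp
next
  case False
  obtain c q where p: "p = pCons c q" by (cases p)
  with False have "q \<noteq> 0" by auto
  \<comment> \<open>The term \<open>\<bar>m\<bar>\<close> excludes negative values far out: these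
    have modulus at most \<open>\<bar>m\<bar>\<close>. Hence far values are positive and exceed
    \<open>poly p 0\<close>.\<close>
  from poly_infinity[OF this, of "\<bar>poly p 0\<bar> + \<bar>m\<bar> + 1" c] obtain r
    where r: "\<And>z. r \<le> norm z \<Longrightarrow> \<bar>poly p 0\<bar> + \<bar>m\<bar> + 1 \<le> norm (poly p z)"
    by (auto simp: p)
  have far: "poly p 0 \<le> poly p z" if "r \<le> norm z" for z
    using r[OF that] assms[of z] by auto
  have "\<exists>x0\<in>cball 0 \<bar>r\<bar>. \<forall>x\<in>cball 0 \<bar>r\<bar>. poly p x0 \<le> poly p x"
    by (rule continuous_attains_inf) (auto intro!: continuous_intros)
  then obtain x0 where x0: "\<And>x. \<bar>x\<bar> \<le> \<bar>r\<bar> \<Longrightarrow> poly p x0 \<le> poly p x"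
    by (metis mem_cball_0 real_norm_def)
  have "poly p x0 \<le> poly p x" for x
  proof (cases "\<bar>x\<bar> \<le> \<bar>r\<bar>")
    case False
    then have "poly p 0 \<le> poly p x" by (intro far) auto
    then show ?thesis using x0[of 0] by simp
  qed (rule x0)
  then show ?thesis by (rule that)
qed

text \<open>Subtracting the minimum leaves a double root at the minimizer, which can be divided out.\<close>

lemma nonneg_poly_sum_of_squares:
  fixes p :: "real poly"
  assumes "\<And>x. 0 \<le> poly p x"
  shows "\<exists>ss. p = (\<Sum>s\<leftarrow>ss. s * s) \<and> (\<forall>s\<in>set ss. 2 * degree s \<le> degree p)"
  using assms
proof (induction "degree p" arbitrary: p rule: less_induct)
  case less
  show ?case
  proof (cases "degree p = 0")
    case True
    then obtain c where p: "p = [:c:]"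
      by (metis degree_eq_zeroE)
    then have "0 \<le> c" using less.prems[of 0] by simp
    then show ?thesis
      by (intro exI[of _ "[[:sqrt c:]]"]) (simp add: p)
  next
    case False
    obtain x0 where x0: "\<And>x. poly p x0 \<le> poly p x"
      using poly_bounded_below_attains_min[OF less.prems] by blast
    define m where "m = poly p x0"
    have m: "0 \<le> m" using less.prems by (simp add: m_def)
    have "poly (p - [:m:]) x0 = 0" by (simp add: m_def)
    then obtain r where r: "p - [:m:] = [:-x0, 1:] * r"
      by (metis poly_eq_0_iff_dvd dvdE)
    \<comment> \<open>The derivative vanishes at the minimizer, which forces the cofactor
      \<open>r\<close> to vanish there as well.\<close>
    have "poly (pderiv p) x0 = 0"
      by (rule DERIV_local_min[OF poly_DERIV, of 1]) (use x0 in auto)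
    moreover have "pderiv p = pderiv (p - [:m:])"
      by (simp add: pderiv_diff pderiv_pCons)
    then have "pderiv p = [:-x0, 1:] * pderiv r + r * pderiv [:-x0, 1:]"
      by (simp only: r pderiv_mult)
    ultimately have "poly r x0 = 0"
      by (simp only: poly_add poly_mult) (simp add: pderiv_pCons)
    then obtain q where q: "r = [:-x0, 1:] * q"
      by (metis poly_eq_0_iff_dvd dvdE)
    have p: "p = [:m:] + [:-x0, 1:] * ([:-x0, 1:] * q)"
      using r q by (simp add: algebra_simps)
    have "q \<noteq> 0" using False p by auto
    moreover have "degree ([:-x0, 1:] * f) = degree f + 1" if "f \<noteq> 0" for f
      using that by (subst degree_mult_eq) auto
    ultimately have "degree ([:-x0, 1:] * ([:-x0, 1:] * q)) = degree q + 2"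
      by (simp del: mult_pCons_left)
    then have deg: "degree p = degree q + 2"
      by (subst p, subst degree_add_eq_right) auto
    have off: "0 \<le> poly q x" if "x \<noteq> x0" for x
    proof -
      have "0 \<le> (x - x0)\<^sup>2 * poly q x"
        using x0[of x] arg_cong[OF p, of "\<lambda>p. poly p x"]
        by (simp add: m_def power2_eq_square algebra_simps)
      then show ?thesis using that by (simp add: zero_le_mult_iff)
    qed
    \<comment> \<open>Dividing by \<open>(x - x0)^2\<close> says nothing at \<open>x0\<close>
      itself; continuity fills the gap.\<close>
    have "0 \<le> poly q x0"
    proof (rule tendsto_lowerbound)
      show "(poly q \<longlongrightarrow> poly q x0) (at x0)"
        using poly_isCont[of x0 q] by (simp add: isCont_def)
      show "\<forall>\<^sub>F x in at x0. 0 \<le> poly q x"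
        using off by (auto simp: eventually_at_filter)
    qed simp
    with off have "\<And>x. 0 \<le> poly q x" by metis
    from less.hyps[OF _ this] deg obtain ss
      where ss: "q = (\<Sum>s\<leftarrow>ss. s * s)" "\<forall>s\<in>set ss. 2 * degree s \<le> degree q"
      by auto
    have "l * (l * (\<Sum>s\<leftarrow>ss. s * s)) = (\<Sum>s\<leftarrow>map ((*) l) ss. s * s)" for l :: "real poly"
      by (induction ss) (simp_all add: algebra_simps)
    \<comment> \<open>The constant \<open>m\<close> is the square of \<open>sqrt m\<close>, and the
      factor \<open>(x - x0)^2\<close> is absorbed into the squares of \<open>q\<close>.\<close>
    from this[of "[:-x0, 1:]"] have "p = (\<Sum>s\<leftarrow>[:sqrt m:] # map ((*) [:-x0, 1:]) ss. s * s)"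
      using m by (subst p, subst ss(1)) simp
    moreover have "2 * degree s \<le> degree p" if "s \<in> set ([:sqrt m:] # map ((*) [:-x0, 1:]) ss)" for s
    proof -
      consider "s = [:sqrt m:]" | s' where "s' \<in> set ss" "s = [:-x0, 1:] * s'"
        using \<open>s \<in> _\<close> by auto
      then show ?thesis
      proof cases
        case 2
        have "degree s \<le> 1 + degree s'"
          unfolding 2 by (rule order_trans[OF degree_mult_le]) simp
        then show ?thesis using ss(2) 2(1) deg by force
      qed simp
    qed
    ultimately show ?thesis by blast
  qed
qed

section \<open>Moment functionals\<close>

text \<open>This is the Riesz functional of a truncated moment sequence. Coefficients above degree
  \<open>2 * d\<close> are ignored, so degree bounds accompany its use.\<close>

definition moment_functional :: "nat \<Rightarrow> rvec \<Rightarrow> real poly \<Rightarrow> real" where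
  "moment_functional d u p = (\<Sum>j<2 * d + 1. coeff p j * u j)"

lemma moment_functional_add:
  "moment_functional d u (p + q) = moment_functional d u p + moment_functional d u q"
  by (simp add: moment_functional_def algebra_simps sum.distrib)

lemma moment_functional_smult:
  "moment_functional d u (smult c p) = c * moment_functional d u p"
  by (simp add: moment_functional_def algebra_simps sum_distrib_left)

lemma moment_functional_sum_list:
  "moment_functional d u (sum_list ps) = (\<Sum>p\<leftarrow>ps. moment_functional d u p)"
  by (induction ps) (simp_all add: moment_functional_add, simp add: moment_functional_def)

text \<open>The coefficients of \<open>s * s\<close> are convolutions, and regrouping them gives the
  Hankel quadratic form at the coefficient vector of \<open>s\<close>.\<close>

lemma moment_functional_square:
  assumes "degree s \<le> d"
  shows "moment_functional d u (s * s) = (\<Sum>i<d+1. \<Sum>j<d+1. coeff s i * u (i + j) * coeff s j)"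
proof -
  let ?g = "\<lambda>i j. coeff s i * u (i + j) * coeff s j"
  have "moment_functional d u (s * s) = (\<Sum>k\<le>2*d. \<Sum>i\<le>k. ?g i (k - i))"
    unfolding moment_functional_def Suc_eq_plus1[symmetric] lessThan_Suc_atMost
    by (auto simp: coeff_mult sum_distrib_right sum_distrib_left mult_ac intro!: sum.cong)
  also have "\<dots> = (\<Sum>(i, j)\<in>{(i, j). i + j \<le> 2*d}. ?g i j)"
    by (rule sum.triangle_reindex_eq[symmetric])
  \<comment> \<open>The square of indices lies inside the triangle; a pair outside the square has an
    index above \<open>d\<close>, where the coefficient of \<open>s\<close> is 0.\<close>
  also have "\<dots> = (\<Sum>(i, j)\<in>{..<d+1} \<times> {..<d+1}. ?g i j)"
  proof (rule sum.mono_neutral_right)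
    show "finite {(i, j). i + j \<le> 2*d}"
      by (rule finite_subset[of _ "{..2*d} \<times> {..2*d}"]) auto
    show "\<forall>i\<in>{(i, j). i + j \<le> 2 * d} - {..<d + 1} \<times> {..<d + 1}. (case i of (i, j) \<Rightarrow> ?g i j) = 0"
      using assms by (auto simp: not_less intro!: coeff_eq_0)
  qed auto
  finally show ?thesis
    by (simp only: sum.cartesian_product)
qed

lemma psd_matrix_hankel_iff:
  "psd_matrix k (\<lambda>i j. u (i + j)) \<longleftrightarrow> (\<forall>z. 0 \<le> (\<Sum>i<k. \<Sum>j<k. z i * u (i + j) * z j))"
  by (simp add: psd_matrix_def add.commute)

text \<open>Each square in a decomposition of \<open>p\<close> has a root of degree at most
  \<open>d\<close>, so its coefficient vector fits the Hankel matrix.\<close>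

lemma moment_functional_nonneg:
  assumes psd: "psd_matrix (d + 1) (\<lambda>i j. u (i + j))"
    and "\<And>z. 0 \<le> poly p z" and "degree p \<le> 2 * d"
  shows "0 \<le> moment_functional d u p"
proof -
  obtain ss where p: "p = (\<Sum>s\<leftarrow>ss. s * s)" and deg: "\<forall>s\<in>set ss. 2 * degree s \<le> degree p"
    using nonneg_poly_sum_of_squares[OF assms(2)] by blast
  have "0 \<le> moment_functional d u (s * s)" if "s \<in> set ss" for s
  proof -
    have "degree s \<le> d" using deg that assms(3) by fastforce
    then show ?thesis
      using psd by (simp only: moment_functional_square psd_matrix_hankel_iff)
  qed
  then show ?thesis
    unfolding p moment_functional_sum_list by (intro sum_list_nonneg) auto
qed

section \<open>Lifted polynomials\<close>

lemma lift_poly_add: "lift_poly d a b (p + q) = lift_poly d a b p + lift_poly d a b q"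
  by (simp add: lift_poly_def smult_add_left sum.distrib)

lemma lift_poly_smult: "lift_poly d a b (smult c p) = smult c (lift_poly d a b p)"
  by (rule poly_eqI) (simp add: lift_poly_def coeff_sum sum_distrib_left mult.assoc)

lemma degree_lift_poly_le: "degree (lift_poly d a b p) \<le> 2 * d"
  unfolding lift_poly_def
proof (intro degree_sum_le finite_atMost order_trans[OF degree_smult_le])
  fix i assume "i \<in> {..d}"
  have "degree ([:a, 0, b:] ^ i) \<le> 2 * i" "degree ([:1, 0, 1::real:] ^ (d - i)) \<le> 2 * (d - i)"
    by (rule order_trans[OF degree_power_le], simp)+
  then show "degree ([:a, 0, b:] ^ i * [:1, 0, 1:] ^ (d - i)) \<le> 2 * d"
    using degree_mult_le[of "[:a, 0, b:] ^ i" "[:1, 0, 1:] ^ (d - i)"] \<open>i \<in> _\<close> by simp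
qed

lemma sum_coeff_powers:
  fixes p :: "real poly"
  assumes "degree p \<le> d"
  shows "(\<Sum>i\<le>d. coeff p i * x ^ i) = poly p x"
  unfolding poly_altdef
  by (rule sum.mono_neutral_right) (use assms in \<open>auto simp: coeff_eq_0\<close>)

text \<open>The factor \<open>(1 + z^2)^(d - i)\<close> brings every monomial of \<open>p\<close> to
  the common denominator \<open>(1 + z^2)^d\<close>.\<close>

lemma poly_lift_poly:
  assumes "degree p \<le> d"
  shows "poly (lift_poly d a b p) z = (1 + z\<^sup>2) ^ d * poly p ((a + b * z\<^sup>2) / (1 + z\<^sup>2))"
proof -
  have pos: "1 + z\<^sup>2 > 0" by (simp add: add_pos_nonneg)
  have "poly (lift_poly d a b p) z
      = (\<Sum>i\<le>d. coeff p i * ((a + b * z\<^sup>2) ^ i * (1 + z\<^sup>2) ^ (d - i)))"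
    by (simp add: lift_poly_def poly_sum power2_eq_square algebra_simps)
  also have "\<dots> = (\<Sum>i\<le>d. (1 + z\<^sup>2) ^ d * (coeff p i * ((a + b * z\<^sup>2) / (1 + z\<^sup>2)) ^ i))"
    using pos by (intro sum.cong) (auto simp: power_divide power_diff)
  also have "\<dots> = (1 + z\<^sup>2) ^ d * poly p ((a + b * z\<^sup>2) / (1 + z\<^sup>2))"
    using assms by (simp add: sum_distrib_left[symmetric] sum_coeff_powers)
  finally show ?thesis .
qed

text \<open>Coefficients at the formal top degree are multiplicative. They replace leading
  coefficients because \<open>b\<close> or \<open>e\<close> may be 0.\<close>

lemma coeff_quadratic_powers_top:
  fixes a b c e :: real
  shows "coeff ([:a, 0, b:] ^ m * [:c, 0, e:] ^ n) (2 * (m + n)) = b ^ m * e ^ n"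
proof -
  have deg: "degree ([:a, 0, b:] ^ m * [:c, 0, e:] ^ n) \<le> 2 * (m + n)" for a b c e :: real and m n
  proof -
    have "degree ([:a, 0, b:] ^ m) \<le> 2 * m" "degree ([:c, 0, e:] ^ n) \<le> 2 * n"
      by (rule order_trans[OF degree_power_le], simp)+
    then show ?thesis
      using degree_mult_le[of "[:a, 0, b:] ^ m" "[:c, 0, e:] ^ n"] by simp
  qed
  have step: "coeff ([:a, 0, b:] * p) (Suc (Suc k)) = b * coeff p k"
    if "degree p \<le> k" for a b :: real and p k
    using that by (simp add: coeff_eq_0)
  have base: "coeff ([:c, 0, e:] ^ n) (2 * n) = e ^ n"
  proof (induction n)
    case (Suc n)
    then show ?case using step[of "[:c, 0, e:] ^ n" "2 * n" c e] deg[of a b 0 c e n] by simp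
  qed simp
  show ?thesis
  proof (induction m)
    case (Suc m)
    have "coeff ([:a, 0, b:] * ([:a, 0, b:] ^ m * [:c, 0, e:] ^ n)) (Suc (Suc (2 * (m + n))))
        = b * (b ^ m * e ^ n)"
      by (simp only: step[OF deg] Suc)
    then show ?case by (simp add: mult.assoc del: mult_pCons_left)
  qed (simp add: base)
qed

text \<open>The top coefficient is the value of the lift at \<open>z = infinity\<close>, which the
  substitution sends to \<open>b\<close>.\<close>

lemma coeff_lift_poly_top:
  assumes "degree p \<le> d"
  shows "coeff (lift_poly d a b p) (2 * d) = poly p b"
proof -
  have "coeff ([:a, 0, b:] ^ i * [:1, 0, 1:] ^ (d - i)) (2 * d) = b ^ i" if "i \<le> d" for i
    using coeff_quadratic_powers_top[of a b i 1 1 "d - i"] that by simp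
  then have "coeff (lift_poly d a b p) (2 * d) = (\<Sum>i\<le>d. coeff p i * b ^ i)"
    by (simp add: lift_poly_def coeff_sum)
  then show ?thesis using assms by (simp add: sum_coeff_powers)
qed

lemma lift_poly_nonneg:
  assumes "degree p \<le> d" "a \<le> b" "\<And>x. x \<in> {a..b} \<Longrightarrow> 0 \<le> poly p x"
  shows "0 \<le> poly (lift_poly d a b p) z"
proof -
  have pos: "1 + z\<^sup>2 > 0" by (simp add: add_pos_nonneg)
  have "a * z\<^sup>2 \<le> b * z\<^sup>2" using assms(2) by (intro mult_right_mono) auto
  then have "(a + b * z\<^sup>2) / (1 + z\<^sup>2) \<in> {a..b}"
    using pos assms(2) by (simp add: field_simps)
  from assms(3)[OF this] show ?thesis
    using pos by (simp add: poly_lift_poly[OF assms(1)])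
qed

text \<open>Point evaluation at the right endpoint \<open>b\<close> corresponds to \<open>z = \<infinity>\<close> and is treated separately.\<close>

lemma point_evaluation_moments:
  assumes "x \<in> {a..b}" "a < b"
  obtains u where "psd_matrix (d + 1) (\<lambda>i j. u (i + j))"
    and "\<And>p. degree p \<le> d \<Longrightarrow> moment_functional d u (lift_poly d a b p) = poly p x"
proof (cases "x = b")
  case True
  \<comment> \<open>A unit atom at infinity contributes to the highest moment only.\<close>
  define u :: rvec where "u = (\<lambda>j. if j = 2 * d then 1 else 0)"
  have "(\<Sum>i<d+1. \<Sum>j<d+1. z i * u (i + j) * z j) = z d * z d" for z
  proof -
    have "(\<Sum>i<d+1. \<Sum>j<d+1. z i * u (i + j) * z j)
        = (\<Sum>i<d+1. \<Sum>j<d+1. if j = d then (if i = d then z i * z j else 0) else 0)"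
      by (intro sum.cong) (auto simp: u_def)
    then show ?thesis by (simp add: sum.delta)
  qed
  then have psd: "psd_matrix (d + 1) (\<lambda>i j. u (i + j))"
    by (simp del: sum.lessThan_Suc add: psd_matrix_hankel_iff)
  have "moment_functional d u q = coeff q (2 * d)" for q
  proof -
    have "moment_functional d u q = (\<Sum>j<2*d+1. if j = 2*d then coeff q j else 0)"
      unfolding moment_functional_def by (intro sum.cong) (auto simp: u_def)
    then show ?thesis by (simp add: sum.delta)
  qed
  with psd True show ?thesis
    by (intro that[of u]) (auto simp: coeff_lift_poly_top)
next
  case False
  with assms have x: "a \<le> x" "x < b" by auto
  \<comment> \<open>This solves \<open>(a + b * z^2) / (1 + z^2) = x\<close>, which is possible
    because \<open>x < b\<close>.\<close>
  define z where "z = sqrt ((x - a) / (b - x))"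
  have z2: "z\<^sup>2 = (x - a) / (b - x)" using x by (simp add: z_def)
  have xz: "(a + b * z\<^sup>2) / (1 + z\<^sup>2) = x"
    using x assms(2) unfolding z2 by (simp add: divide_simps) (simp add: algebra_simps)
  have pos: "1 + z\<^sup>2 > 0" by (simp add: add_pos_nonneg)
  \<comment> \<open>An atom at \<open>z\<close> whose weight cancels the factor
    \<open>(1 + z^2)^d\<close> of the lift; its Hankel matrix has rank one.\<close>
  define u :: rvec where "u = (\<lambda>j. z ^ j / (1 + z\<^sup>2) ^ d)"
  have "(\<Sum>i<d+1. \<Sum>j<d+1. v i * u (i + j) * v j) = (\<Sum>i<d+1. v i * z ^ i)\<^sup>2 / (1 + z\<^sup>2) ^ d" for v
    by (simp only: u_def power2_eq_square sum_product sum_divide_distrib power_add)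
      (simp add: mult_ac)
  then have psd: "psd_matrix (d + 1) (\<lambda>i j. u (i + j))"
    using pos by (simp del: sum.lessThan_Suc add: psd_matrix_hankel_iff)
  have "moment_functional d u q = poly q z / (1 + z\<^sup>2) ^ d" if "degree q \<le> 2 * d" for q
  proof -
    have "moment_functional d u q = (\<Sum>j\<le>2*d. coeff q j * z ^ j) / (1 + z\<^sup>2) ^ d"
      unfolding moment_functional_def Suc_eq_plus1[symmetric] lessThan_Suc_atMost
      by (simp add: u_def sum_divide_distrib)
    then show ?thesis using that by (simp add: sum_coeff_powers)
  qed
  with psd xz pos show ?thesis
    by (intro that[of u]) (auto simp: degree_lift_poly_le poly_lift_poly)
qed

section \<open>The cone of the moment representation\<close>

lemma prod_cone_orthant: "prod_cone (orthant m) (orthant n) = orthant (m + n)"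
proof -
  have "\<exists>y z. x = vconcat m y z \<and> y \<in> snd (orthant m) \<and> z \<in> snd (orthant n)"
    if "x \<in> snd (orthant (m + n))" for x
    using that
    by (intro exI[of _ "trunc m x"] exI[of _ "\<lambda>i. x (m + i)"])
      (auto simp: orthant_def topspace_Euclidean_space vconcat_def trunc_def)
  moreover have "vconcat m y z \<in> snd (orthant (m + n))"
    if "y \<in> snd (orthant m)" "z \<in> snd (orthant n)" for y z
    using that by (auto simp: orthant_def topspace_Euclidean_space vconcat_def)
  ultimately show ?thesis
    by (auto simp: prod_cone_def orthant_def)
qed

lemma orthant_in_cone_family:
  assumes "cone_family \<K>"
  shows "orthant (Suc n) \<in> \<K>"
proof (induction n)
  case 0
  then show ?case using assms by (simp add: cone_family_def)
next
  case (Suc n)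
  then have "prod_cone (orthant 1) (orthant (Suc n)) \<in> \<K>"
    using assms unfolding cone_family_def by blast
  then show ?case by (simp add: prod_cone_orthant)
qed

lemma mem_prod_orthant_iff:
  "w \<in> snd (prod_cone (orthant m) K) \<longleftrightarrow> (\<forall>i<m. 0 \<le> w i) \<and> (\<lambda>l. w (m + l)) \<in> snd K"
proof
  assume "w \<in> snd (prod_cone (orthant m) K)"
  then obtain x y where "w = vconcat m x y" "x \<in> snd (orthant m)" "y \<in> snd K"
    by (auto simp: prod_cone_def orthant_def split: prod.splits)
  then show "(\<forall>i<m. 0 \<le> w i) \<and> (\<lambda>l. w (m + l)) \<in> snd K"
    by (auto simp: vconcat_def orthant_def)
next
  assume R: "(\<forall>i<m. 0 \<le> w i) \<and> (\<lambda>l. w (m + l)) \<in> snd K"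
  have "w = vconcat m (trunc m w) (\<lambda>l. w (m + l))"
    by (auto simp: vconcat_def trunc_def)
  moreover have "trunc m w \<in> snd (orthant m)"
    using R by (auto simp: orthant_def topspace_Euclidean_space trunc_def)
  ultimately have "\<exists>x y. w = vconcat m x y \<and> x \<in> snd (orthant m) \<and> y \<in> snd K"
    using R by blast
  then show "w \<in> snd (prod_cone (orthant m) K)"
    by (cases K) (simp add: prod_cone_def orthant_def)
qed

text \<open>The pairing enumerates antidiagonals: \<open>l = triangle (p + q) + p\<close>, so
  \<open>l\<close> lies between \<open>triangle (p + q)\<close> and
  \<open>triangle (p + q + 1)\<close>.\<close>

lemma less_triangle_iff:
  assumes "prod_decode l = (p, q)"
  shows "l < triangle k \<longleftrightarrow> p + q < k"
proof -
  have l: "l = triangle (p + q) + p"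
    using prod_decode_inverse[of l] unfolding assms by (simp add: prod_encode_def)
  have mono: "triangle i \<le> triangle j" if "i \<le> j" for i j
    using that by (induction rule: dec_induct) auto
  show ?thesis
  proof
    assume "l < triangle k"
    then show "p + q < k" using l mono[of k "p + q"] by force
  next
    assume "p + q < k"
    then show "l < triangle k" using l mono[of "Suc (p + q)" k] by simp
  qed
qed

lemma svec_eqD:
  assumes "svec k M = svec k N" "i \<le> j" "j < k"
  shows "M i j = N i j"
proof -
  let ?l = "prod_encode (i, j - i)"
  have "?l < triangle k" using assms less_triangle_iff[of ?l i "j - i" k] by simp
  moreover have "svec_weight (j - i) \<noteq> 0" by (simp add: svec_weight_def)
  ultimately show ?thesis
    using fun_cong[OF assms(1), of ?l] assms(2) by (simp add: svec_def trunc_def)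
qed

text \<open>The cone is an image under \<open>svec\<close>, so membership only yields some
  semidefinite preimage. Symmetry and injectivity of \<open>svec\<close> on the upper triangle make
  it agree with \<open>M\<close> on the \<open>k\<close> by \<open>k\<close> block.\<close>

lemma svec_in_semidefinite_cone_iff:
  assumes "\<And>i j. M i j = M j i"
  shows "svec k M \<in> snd (semidefinite_cone k) \<longleftrightarrow> psd_matrix k M"
proof
  assume "svec k M \<in> snd (semidefinite_cone k)"
  then obtain N where N: "svec k M = svec k N" "psd_matrix k N"
    by (auto simp: semidefinite_cone_def)
  have eq: "M i j = N i j" if "i < k" "j < k" for i j
    using svec_eqD[OF N(1), of i j] svec_eqD[OF N(1), of j i] that N(2) assms[of i j]
    by (cases "i \<le> j") (auto simp: psd_matrix_def)
  then have "(\<Sum>i<k. \<Sum>j<k. z i * M i j * z j) = (\<Sum>i<k. \<Sum>j<k. z i * N i j * z j)" for z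
    by (intro sum.cong) auto
  then show "psd_matrix k M"
    using N(2) assms unfolding psd_matrix_def by metis
qed (auto simp: semidefinite_cone_def)

text \<open>Everything after this works with the functional \<open>L\<close> and the Hankel matrix
  instead of the encoded rows.\<close>

lemma satisfies_moment_representation:
  fixes a b :: real and \<alpha> \<beta> :: "real poly"
  defines "d \<equiv> max (degree \<alpha>) (degree \<beta>) + 1"
  defines "L \<equiv> \<lambda>u p. moment_functional d u (lift_poly d a b p)"
  shows "satisfies (moment_representation a b \<alpha> \<beta>) (t, g, x) u \<longleftrightarrow>
    L u ([:0, 1:] * \<alpha>) \<le> t \<and> L u \<alpha> = g \<and> L u ([:0, 1:] * \<beta>) = x \<and> L u \<beta> = 1 \<and>
    psd_matrix (d + 1) (\<lambda>i j. u (i + j))"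
proof -
  define S where "S = scalar_rows d a b \<alpha> \<beta>"
  define R where "R = moment_representation a b \<alpha> \<beta>"
  let ?k = "d + 1"
  have R: "R = \<lparr> con_cone = prod_cone (orthant 7) (semidefinite_cone ?k),
        num_aux = 2 * d + 1,
        row_A = (\<lambda>i. if i < 7 then fst (S ! i) else 0),
        mat_B = (\<lambda>i j. if i < 7 then coeff (fst (snd (S ! i))) j
                 else case prod_decode (i - 7) of (p, q) \<Rightarrow>
                        if j = p + (p + q) then - svec_weight q else 0),
        rhs_c = (\<lambda>i. if i < 7 then snd (snd (S ! i)) else 0) \<rparr>"
    unfolding R_def moment_representation_def Let_def S_def d_def ..
  have dim: "fst (con_cone R) = 7 + triangle ?k"
    by (simp add: R prod_cone_def orthant_def semidefinite_cone_def)
  \<comment> \<open>The slack vector: its first seven coordinates belong to the scalar rows, the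
    others form the vectorised Hankel matrix.\<close>
  define w where "w = (\<lambda>i. trunc (fst (con_cone R)) (rhs_c R) i
    - trunc (fst (con_cone R)) (\<lambda>i. row_A R i \<bullet> (t, g, x) + (\<Sum>j<num_aux R. mat_B R i j * u j)) i)"
  have "satisfies R (t, g, x) u \<longleftrightarrow> w \<in> snd (con_cone R)"
    by (simp only: satisfies_def cone_le_def w_def)
  also have "\<dots> \<longleftrightarrow> (\<forall>i<7. 0 \<le> w i) \<and> (\<lambda>l. w (7 + l)) \<in> snd (semidefinite_cone ?k)"
    by (simp add: R mem_prod_orthant_iff)
  also have "(\<lambda>l. w (7 + l)) = svec ?k (\<lambda>i j. u (i + j))"
  proof
    fix l
    obtain p q where pq: "prod_decode l = (p, q)" by fastforce
    show "w (7 + l) = svec ?k (\<lambda>i j. u (i + j)) l"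
    proof (cases "l < triangle ?k")
      case True
      then have "p + q < ?k" using less_triangle_iff[OF pq] by blast
      \<comment> \<open>The matrix entry at \<open>(p, p + q)\<close> is the moment with index
        \<open>p + (p + q)\<close>; this bound keeps it within the additional variables.\<close>
      then have "p + (p + q) < 2 * d + 1" by simp
      moreover have "(\<Sum>j<2*d+1. (if j = p + (p + q) then - svec_weight q else 0) * u j)
          = (\<Sum>j<2*d+1. if j = p + (p + q) then - svec_weight q * u j else 0)"
        by (intro sum.cong) auto
      ultimately show ?thesis
        using True unfolding w_def dim by (simp add: R trunc_def svec_def pq)
    next
      case False
      then show ?thesis unfolding w_def dim by (simp add: trunc_def svec_def)
    qed
  qed
  also have "\<dots> \<in> snd (semidefinite_cone ?k) \<longleftrightarrow> psd_matrix ?k (\<lambda>i j. u (i + j))"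
    by (rule svec_in_semidefinite_cone_iff) (simp add: add.commute)
  also have "(\<forall>i<7. 0 \<le> w i) \<longleftrightarrow>
      L u ([:0, 1:] * \<alpha>) \<le> t \<and> L u \<alpha> = g \<and> L u ([:0, 1:] * \<beta>) = x \<and> L u \<beta> = 1"
  proof -
    have w: "w i = snd (snd (S ! i)) - (fst (S ! i) \<bullet> (t, g, x)
        + moment_functional d u (fst (snd (S ! i))))" if "i < 7" for i
      using that unfolding w_def dim by (simp add: R trunc_def moment_functional_def)
    have neg: "moment_functional d u (- p) = - moment_functional d u p" for p
      by (simp add: moment_functional_def sum_negf)
    \<comment> \<open>With explicit indices the list lookups evaluate, and opposite inequalities
      merge into equations.\<close>
    have "(\<forall>i<7. 0 \<le> w i) \<longleftrightarrow> (\<forall>i\<in>{0,1,2,3,4,5,6}. 0 \<le> w i)"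
    proof -
      have "{..<7::nat} = {0,1,2,3,4,5,6}" by auto
      then show ?thesis by (metis lessThan_iff)
    qed
    then show ?thesis
      by (auto simp: w S_def scalar_rows_def Let_def L_def neg)
  qed
  finally show ?thesis by (simp add: R_def conj_assoc)
qed

text \<open>The scalar constraints are jointly linear in \<open>y\<close> and \<open>u\<close>, and
  semidefiniteness survives convex combinations, so the two moment vectors can be combined with the
  same weights.\<close>

lemma convex_projection_moment_representation:
  "convex (projection (moment_representation a b \<alpha> \<beta>))"
proof (rule convexI)
  fix y y' :: "real \<times> real \<times> real" and r s :: real
  assume y: "y \<in> projection (moment_representation a b \<alpha> \<beta>)"
    "y' \<in> projection (moment_representation a b \<alpha> \<beta>)" and rs: "0 \<le> r" "0 \<le> s" "r + s = 1"
  define d where "d = max (degree \<alpha>) (degree \<beta>) + 1"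
  note sat = satisfies_moment_representation[where \<alpha> = \<alpha> and \<beta> = \<beta>, folded d_def]
  obtain t g x t' g' x' where yy: "y = (t, g, x)" "y' = (t', g', x')"
    by (metis prod_cases3)
  obtain u u' where u: "satisfies (moment_representation a b \<alpha> \<beta>) (t, g, x) u"
    "satisfies (moment_representation a b \<alpha> \<beta>) (t', g', x') u'"
    using y by (auto simp: projection_def yy)
  define v where "v = (\<lambda>j. r * u j + s * u' j)"
  have lin: "moment_functional d v p = r * moment_functional d u p + s * moment_functional d u' p" for p
    by (simp add: moment_functional_def v_def algebra_simps sum.distrib sum_distrib_left)
  have comb: "(\<Sum>i<d+1. \<Sum>j<d+1. z i * v (i + j) * z j)
      = r * (\<Sum>i<d+1. \<Sum>j<d+1. z i * u (i + j) * z j)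
      + s * (\<Sum>i<d+1. \<Sum>j<d+1. z i * u' (i + j) * z j)" for z
    by (simp only: v_def sum_distrib_left sum.distrib[symmetric])
      (intro sum.cong refl, simp add: algebra_simps)
  have "psd_matrix (d + 1) (\<lambda>i j. v (i + j))"
    using u rs unfolding sat psd_matrix_hankel_iff comb by (simp del: sum.lessThan_Suc)
  moreover have "r * p + s * q \<le> r * p' + s * q'" if "p \<le> p'" "q \<le> q'" for p q p' q' :: real
    using that rs by (intro add_mono mult_left_mono) auto
  ultimately have "satisfies (moment_representation a b \<alpha> \<beta>) (r * t + s * t', r * g + s * g', r * x + s * x') v"
    using u rs unfolding sat lin by auto
  then show "r *\<^sub>R y + s *\<^sub>R y' \<in> projection (moment_representation a b \<alpha> \<beta>)"
    by (auto simp: projection_def yy)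
qed

section \<open>The projection of the moment representation\<close>

context
  fixes a b :: real and \<alpha> \<beta> :: "real poly" and F :: "real \<Rightarrow> real"
  assumes ab: "a < b"
    and pos: "\<And>x. x \<in> {a..b} \<Longrightarrow> 0 < poly \<beta> x"
    and F: "\<And>x. F x = poly \<alpha> x / poly \<beta> x"
begin

lemma continuous_on_rational_field: "continuous_on {a..b} F"
proof -
  have "continuous_on {a..b} (\<lambda>x. poly \<alpha> x / poly \<beta> x)"
    using pos by (intro continuous_intros) force
  then show ?thesis by (simp add: F)
qed

lemma projection_moment_representation_upward:
  assumes "(t, g, x) \<in> projection (moment_representation a b \<alpha> \<beta>)" "t \<le> t'"
  shows "(t', g, x) \<in> projection (moment_representation a b \<alpha> \<beta>)"
proof -
  obtain u where "satisfies (moment_representation a b \<alpha> \<beta>) (t, g, x) u"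
    using assms(1) by (auto simp: projection_def)
  then have "satisfies (moment_representation a b \<alpha> \<beta>) (t', g, x) u"
    using assms(2) unfolding satisfies_moment_representation by auto
  then show ?thesis by (auto simp: projection_def)
qed

lemma curve_in_projection:
  assumes "x \<in> {a..b}"
  shows "(x * F x, F x, x) \<in> projection (moment_representation a b \<alpha> \<beta>)"
proof -
  define d where "d = max (degree \<alpha>) (degree \<beta>) + 1"
  obtain u where u: "psd_matrix (d + 1) (\<lambda>i j. u (i + j))"
    "\<And>p. degree p \<le> d \<Longrightarrow> moment_functional d u (lift_poly d a b p) = poly p x"
    using point_evaluation_moments[OF assms ab, of d] by metis
  \<comment> \<open>Dividing point evaluation by \<open>poly \<beta> x\<close> achieves the
    normalisation \<open>L(\<beta>) = 1\<close> and turns \<open>L(\<alpha>)\<close> into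
    \<open>F x\<close>.\<close>
  define v where "v = (\<lambda>j. u j / poly \<beta> x)"
  have b: "0 < poly \<beta> x" using pos assms by blast
  have scale: "(\<Sum>i<d+1. \<Sum>j<d+1. z i * v (i + j) * z j)
      = (\<Sum>i<d+1. \<Sum>j<d+1. z i * u (i + j) * z j) / poly \<beta> x" for z
    by (simp add: v_def sum_divide_distrib del: sum.lessThan_Suc)
  have "psd_matrix (d + 1) (\<lambda>i j. v (i + j))"
    using u(1) b unfolding psd_matrix_hankel_iff scale by (simp del: sum.lessThan_Suc)
  moreover have "moment_functional d v (lift_poly d a b p) = poly p x / poly \<beta> x" if "degree p \<le> d" for p
    using u(2)[OF that] by (simp add: moment_functional_def v_def flip: sum_divide_distrib)
  \<comment> \<open>The summand 1 in \<open>d\<close> makes room for the extra factor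
    \<open>[:0, 1:]\<close>.\<close>
  moreover have "degree \<alpha> \<le> d" "degree \<beta> \<le> d" "degree ([:0, 1:] * \<alpha>) \<le> d" "degree ([:0, 1:] * \<beta>) \<le> d"
    by (auto simp: d_def intro!: order_trans[OF degree_mult_le])
  ultimately have "satisfies (moment_representation a b \<alpha> \<beta>) (x * F x, F x, x) v"
    using b unfolding satisfies_moment_representation d_def[symmetric]
    by (simp add: F del: mult_pCons_left)
  then show ?thesis by (auto simp: projection_def)
qed

text \<open>The witness is \<open>s = L([:0, 1:] * \<alpha>)\<close>: lowering \<open>t\<close> to
  the exact moment leaves a point that no hyperplane separates from the hull.\<close>

lemma moments_in_convex_hull:
  assumes "satisfies (moment_representation a b \<alpha> \<beta>) (t, g, x) u"
  obtains s where "s \<le> t" "(s, g, x) \<in> convex hull ((\<lambda>x. (x * F x, F x, x)) ` {a..b})"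
proof -
  define d where "d = max (degree \<alpha>) (degree \<beta>) + 1"
  define L where "L = (\<lambda>p. moment_functional d u (lift_poly d a b p))"
  have L: "L ([:0, 1:] * \<alpha>) \<le> t" "L \<alpha> = g" "L ([:0, 1:] * \<beta>) = x" "L \<beta> = 1"
    and psd: "psd_matrix (d + 1) (\<lambda>i j. u (i + j))"
    using assms unfolding satisfies_moment_representation d_def L_def by auto
  let ?C = "convex hull ((\<lambda>x. (x * F x, F x, x)) ` {a..b})"
  let ?y = "(L ([:0, 1:] * \<alpha>), g, x)"
  have "?y \<in> ?C"
  proof (rule ccontr)
    assume "?y \<notin> ?C"
    moreover have "closed ?C"
      by (intro compact_imp_closed compact_convex_hull compact_continuous_image continuous_intros
          continuous_on_rational_field) auto
    ultimately obtain c c0 where c: "c \<bullet> ?y < c0" "\<And>y. y \<in> ?C \<Longrightarrow> c0 < c \<bullet> y"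
      using separating_hyperplane_closed_point[of ?C ?y] convex_convex_hull by blast
    obtain c1 c2 c3 where c123: "c = (c1, c2, c3)" by (metis prod_cases3)
    \<comment> \<open>On \<open>[a, b]\<close> this is \<open>\<beta>\<close> times the separating
      affine function \<open>c \<bullet> y - c0\<close> taken along the curve.\<close>
    define p where "p = smult c1 ([:0, 1:] * \<alpha>) + smult c2 \<alpha> + smult c3 ([:0, 1:] * \<beta>)
      + smult (- c0) \<beta>"
    have "degree p \<le> d"
      unfolding p_def
      by (intro degree_add_le order_trans[OF degree_smult_le] order_trans[OF degree_mult_le])
        (auto simp: d_def)
    moreover have "0 \<le> poly p x" if x: "x \<in> {a..b}" for x
    proof -
      have "c0 < c \<bullet> (x * F x, F x, x)"
        using x by (intro c(2) hull_inc) auto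
      then have "0 \<le> poly \<beta> x * (c1 * (x * F x) + c2 * F x + c3 * x - c0)"
        using pos[OF x] by (intro mult_nonneg_nonneg) (auto simp: c123)
      also have "\<dots> = poly p x"
        using pos[OF x] by (simp add: p_def F field_simps)
      finally show ?thesis .
    qed
    ultimately have "0 \<le> L p"
      unfolding L_def using ab
      by (intro moment_functional_nonneg psd lift_poly_nonneg degree_lift_poly_le) auto
    also have "L p = c1 * L ([:0, 1:] * \<alpha>) + c2 * L \<alpha> + c3 * L ([:0, 1:] * \<beta>) - c0 * L \<beta>"
      unfolding p_def L_def
      by (simp only: lift_poly_add lift_poly_smult moment_functional_add moment_functional_smult)
    \<comment> \<open>As \<open>L \<beta> = 1\<close>, the value is
      \<open>c \<bullet> ?y - c0\<close>, negative by separation.\<close>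
    also have "\<dots> < 0" using c(1) L by (simp add: c123)
    finally show False by simp
  qed
  with L(1) show ?thesis by (rule that)
qed

lemma projection_moment_representation:
  "projection (moment_representation a b \<alpha> \<beta>) =
    convex hull ((\<lambda>x. (x * F x, F x, x)) ` {a..b}) + {(t, 0, 0) | t. t \<ge> 0}"
  (is "?P = ?C + ?T")
proof (intro equalityI subsetI)
  fix y assume "y \<in> ?P"
  then obtain t g x u where y: "y = (t, g, x)" "satisfies (moment_representation a b \<alpha> \<beta>) (t, g, x) u"
    by (cases y) (auto simp: projection_def)
  obtain s where "s \<le> t" "(s, g, x) \<in> ?C"
    using moments_in_convex_hull[OF y(2)] .
  moreover have "y = (s, g, x) + (t - s, 0, 0)" by (simp add: y)
  ultimately show "y \<in> ?C + ?T" by (auto simp del: add_Pair intro!: set_plus_intro)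
next
  fix y assume "y \<in> ?C + ?T"
  then obtain c s where y: "y = c + (s, 0, 0)" "c \<in> ?C" "0 \<le> s"
    by (auto simp: set_plus_def)
  have "?C \<subseteq> ?P"
    using curve_in_projection by (intro hull_minimal convex_projection_moment_representation) auto
  with y show "y \<in> ?P"
    by (cases c) (auto intro: projection_moment_representation_upward)
qed

end

section \<open>Convexity and upward closure of \<open>field_set\<close>\<close>

lemma field_set_upward: "(t, g, x) \<in> field_set F X \<Longrightarrow> t \<le> t' \<Longrightarrow> (t', g, x) \<in> field_set F X"
  by (force simp: field_set_def)

text \<open>For each fixed test point \<open>z\<close> the defining inequality is affine in
  \<open>(t, g, x)\<close>.\<close>

lemma convex_field_set:
  assumes "convex X"
  shows "convex (field_set F X)"
proof (rule convexI)
  fix y y' and r s :: real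
  assume y: "y \<in> field_set F X" "y' \<in> field_set F X" and rs: "0 \<le> r" "0 \<le> s" "r + s = 1"
  obtain t g x t' g' x' where yy: "y = (t, g, x)" "y' = (t', g', x')"
    by (metis prod_cases3)
  have X: "x \<in> X" "x' \<in> X" using y by (auto simp: yy field_set_def)
  have "F z \<bullet> (r *\<^sub>R x + s *\<^sub>R x' - z) \<le> r * t + s * t' - (r *\<^sub>R g + s *\<^sub>R g') \<bullet> z" if "z \<in> X" for z
  proof -
    have "r *\<^sub>R x + s *\<^sub>R x' - z = r *\<^sub>R (x - z) + s *\<^sub>R (x' - z)"
      using rs(3) by (simp add: algebra_simps flip: scaleR_add_left)
    then have "F z \<bullet> (r *\<^sub>R x + s *\<^sub>R x' - z) = r * (F z \<bullet> (x - z)) + s * (F z \<bullet> (x' - z))"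
      by (simp only: inner_add_right inner_scaleR_right)
    also have "\<dots> \<le> r * (t - g \<bullet> z) + s * (t' - g' \<bullet> z)"
      using y that rs by (intro add_mono mult_left_mono) (auto simp: yy field_set_def)
    finally show ?thesis by (simp add: algebra_simps inner_add_left)
  qed
  then show "r *\<^sub>R y + s *\<^sub>R y' \<in> field_set F X"
    using convexD[OF assms X rs] by (simp add: yy field_set_def)
qed

text \<open>For such a triple the defining inequality is monotonicity between \<open>x\<close> and
  \<open>y\<close>, rearranged.\<close>

lemma graph_in_field_set:
  assumes "monotone_field F X" "x \<in> X"
  shows "(F x \<bullet> x, F x, x) \<in> field_set F X"
proof -
  have "F y \<bullet> (x - y) \<le> F x \<bullet> x - F x \<bullet> y" if "y \<in> X" for y
  proof -
    have "0 \<le> (F x - F y) \<bullet> (x - y)"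
      using assms that by (auto simp: monotone_field_def)
    then show ?thesis by (simp add: inner_diff_left inner_diff_right)
  qed
  then show ?thesis using assms(2) by (simp add: field_set_def)
qed

theorem mainTheorem14:
  fixes \<K> :: "econe set"
    and a b :: real
    and \<alpha> \<beta> :: "real poly"
    and F :: "real \<Rightarrow> real"
    and Y_plus :: "(real \<times> real \<times> real) set"
  assumes "cone_family \<K>"
    and "\<And>k. k \<ge> 1 \<Longrightarrow> semidefinite_cone k \<in> \<K>"
    and "a < b"
    and "\<And>x. x \<in> {a..b} \<Longrightarrow> poly \<beta> x > 0"
  defines "F \<equiv> \<lambda>x. poly \<alpha> x / poly \<beta> x"
  assumes "mono_on {a..b} F"
  defines "Y_plus \<equiv>
    convex hull ((\<lambda>x. (x * F x, F x, x)) ` {a..b}) + {(t, 0, 0) | t. t \<ge> 0}"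
  shows "K_representation \<K> (moment_representation a b \<alpha> \<beta>) Y_plus \<and>
         field_K_representation \<K> (moment_representation a b \<alpha> \<beta>) F {a..b}"
proof -
  let ?R = "moment_representation a b \<alpha> \<beta>"
  note F = meta_eq_to_obj_eq[OF F_def, THEN fun_cong]
  have "orthant 7 \<in> \<K>"
    using orthant_in_cone_family[OF assms(1), of 6] by simp
  then have cone: "con_cone ?R \<in> \<K>"
    using assms(1,2) by (simp add: moment_representation_def Let_def cone_family_def)
  have proj: "projection ?R = Y_plus"
    unfolding Y_plus_def using assms(3,4) F by (rule projection_moment_representation)
  have mono: "monotone_field F {a..b}"
    unfolding monotone_field_def
  proof (intro ballI)
    fix x y assume "x \<in> {a..b}" "y \<in> {a..b}"
    then show "0 \<le> (F x - F y) \<bullet> (x - y)"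
      using mono_onD[OF assms(6), of x y] mono_onD[OF assms(6), of y x]
      by (cases "x \<le> y") (auto simp: zero_le_mult_iff)
  qed
  \<comment> \<open>Condition (i): \<open>field_set\<close> is convex, contains the curve by
    monotonicity and is closed under increasing \<open>t\<close>, so it contains
    \<open>Y_plus\<close>.\<close>
  have "convex hull ((\<lambda>x. (x * F x, F x, x)) ` {a..b}) \<subseteq> field_set F {a..b}"
    using graph_in_field_set[OF mono]
    by (intro hull_minimal convex_field_set) (auto simp: mult.commute)
  then have "Y_plus \<subseteq> field_set F {a..b}"
    unfolding Y_plus_def by (fastforce simp: set_plus_def intro: field_set_upward)
  moreover have "continuous_on {a..b} F"
    using assms(3,4) F by (rule continuous_on_rational_field)
  moreover have "(F x \<bullet> x, F x, x) \<in> projection ?R" if "x \<in> {a..b}" for x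
    using curve_in_projection[OF assms(3,4) F that] by (simp add: mult.commute)
  moreover have "(t', g, x) \<in> projection ?R" if "(t, g, x) \<in> projection ?R" "t \<le> t'" for t g x t'
    using assms(3,4) F that by (rule projection_moment_representation_upward)
  ultimately show ?thesis
    unfolding K_representation_def field_K_representation_def
    using cone proj mono assms(3) by auto
qed

end
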